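(* Let $(V,\lhd,\rhd,\circ)$ be a pre-Gel'fand-Dorfman algebra over $\mathbb{C}$ and set $a\star b=a\rhd b+b\lhd a$ for all $a,b\in V$. If $(V,\lhd,\rhd)$ is a simple pre-Novikov algebra and $V=V\star V$, then the quadratic left-symmetric conformal algebra $R=\mathbb{C}[\partial]V$ corresponding to $(V,\lhd,\rhd,\circ)$ is simple.
   Context: All vector spaces are over $\mathbb{C}$. $V\star V$ denotes the linear span of all products $a\star b$. A left-symmetric algebra $(A,\circ)$ is a vector space with a bilinear product satisfying $(a\circ b)\circ c-a\circ(b\circ c)=(b\circ a)\circ c-b\circ(a\circ c)$. A left-symmetric conformal algebra is a $\mathbb{C}[\partial]$-module $R$ with a $\mathbb{C}$-bilinear map $R\times R\to R[\lambda]$, $(a,b)\mapsto a_\lambda b$, such that $\partial a_\lambda b=-\lambda a_\lambda b$, $a_\lambda\partial b=(\partial+\lambda)a_\lambda b$ (conformal sesquilinearity), and $(a_\lambda b)_{\lambda+\mu}c-a_\lambda(b_\mu c)=(b_\mu a)_{\lambda+\mu}c-b_\mu(a_\lambda c)$. An ideal of $R$ is a $\mathbb{C}[\partial]$-submodule $I$ with $I_\lambda R\subseteq I[\lambda]$ and $R_\lambda I\subseteq I[\lambda]$; it is proper if $I\neq 0,R$. $R$ is simple if it is non-trivial (its $\lambda$-product is not identically zero) and has no proper ideals. A pre-Novikov algebra $(A,\lhd,\rhd)$ is a vector space with two bilinear operations such that for all $a,b,c\in A$: $a\rhd(b\rhd c)=(a\rhd b+a\lhd b)\rhd c+b\rhd(a\rhd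 c)-(b\rhd a+b\lhd a)\rhd c$; $a\rhd(b\lhd c)=(a\rhd b)\lhd c+b\lhd(a\lhd c+a\rhd c)-(b\lhd a)\lhd c$; $(a\lhd b+a\rhd b)\rhd c=(a\rhd c)\lhd b$; $(a\lhd b)\lhd c=(a\lhd c)\lhd b$. An ideal of $(V,\lhd,\rhd)$ is a subspace $I$ with $a\lhd b,\,b\lhd a,\,a\rhd b,\,b\rhd a\in I$ for all $a\in I$, $b\in V$; it is proper if $I\neq 0,V$. $(V,\lhd,\rhd)$ is simple if it is non-trivial (its operations are not both identically zero) and has no proper ideals. A pre-Gel'fand-Dorfman algebra $(A,\lhd,\rhd,\circ)$ is a vector space such that $(A,\lhd,\rhd)$ is a pre-Novikov algebra, $(A,\circ)$ is a left-symmetric algebra, and for all $a,b,c$: $c\lhd(a\circ b-b\circ a)-a\circ(c\lhd b)-(b\circ c)\lhd a=-b\circ(c\lhd a)-(a\circ c)\lhd b$; $(a\circ b-b\circ a)\rhd c+(a\lhd b+a\rhd b)\circ c=a\rhd(b\circ c)-b\circ(a\rhd c)+(a\circ c)\lhd b$. The quadratic left-symmetric conformal algebra corresponding to $(V,\lhd,\rhd,\circ)$ is the free $\mathbb{C}[\partial]$-module $R=\mathbb{C}[\partial]V=\mathbb{C}[\partial]\otimes V$ with $a_\lambda b=\partial(b\lhd a)+a\circ b+\lambda(a\rhd b+b\lhd a)$ for $a,b\in V$, extended by conformal sesquilinearity (this is a left-symmetric conformal algebra). *)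

theory Defs
  imports "HOL-Computational_Algebra.Polynomial"
begin

text \<open>
  For an \<open>A\<close>-module \<open>M\<close>, the type of polynomials with coefficients in \<open>M\<close> represents
  \<open>M[x] = A[x] \<otimes> M\<close>; \<open>poly_act\<close> is its \<open>A[x]\<close>-module structure. Iterating it gives
  \<open>\<complex>[\<partial>] \<otimes> V\<close> over \<open>\<complex>[\<partial>]\<close>, and \<open>R[\<lambda>]\<close>, \<open>R[\<lambda>, \<mu>]\<close> over \<open>\<complex>[\<partial>][\<lambda>]\<close>,
  \<open>\<complex>[\<partial>][\<lambda>][\<mu>]\<close> for a \<open>\<complex>[\<partial>]\<close>-module \<open>R\<close>. The variable adjoined last is outermost.
\<close>

definition poly_act ::
  "('a::zero \<Rightarrow> 'm::comm_monoid_add \<Rightarrow> 'm) \<Rightarrow> 'a poly \<Rightarrow> 'm poly \<Rightarrow> 'm poly" where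
  "poly_act s p q = (\<Sum>i\<le>degree p. \<Sum>j\<le>degree q. monom (s (coeff p i) (coeff q j)) (i + j))"

definition bilinear_map ::
  "('a::comm_ring_1 \<Rightarrow> 'm::ab_group_add \<Rightarrow> 'm) \<Rightarrow> ('a \<Rightarrow> 'n::ab_group_add \<Rightarrow> 'n)
     \<Rightarrow> ('m \<Rightarrow> 'm \<Rightarrow> 'n) \<Rightarrow> bool" where
  "bilinear_map s t f \<longleftrightarrow>
     (\<forall>a. module_hom s t (\<lambda>b. f a b)) \<and> (\<forall>b. module_hom s t (\<lambda>a. f a b))"


subsection \<open>Left-symmetric, pre-Novikov and pre-Gel'fand-Dorfman algebras\<close>

locale left_symmetric_algebra = vector_space scale
  for scale :: "complex \<Rightarrow> 'v::ab_group_add \<Rightarrow> 'v" +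
  fixes circ :: "'v \<Rightarrow> 'v \<Rightarrow> 'v" (infixl "\<circ>\<^sub>V" 70)
  assumes circ_bilinear: "bilinear_map scale scale (\<circ>\<^sub>V)"
    and left_symmetric:
      "(a \<circ>\<^sub>V b) \<circ>\<^sub>V c - a \<circ>\<^sub>V (b \<circ>\<^sub>V c) = (b \<circ>\<^sub>V a) \<circ>\<^sub>V c - b \<circ>\<^sub>V (a \<circ>\<^sub>V c)"

locale pre_novikov_algebra = vector_space scale
  for scale :: "complex \<Rightarrow> 'v::ab_group_add \<Rightarrow> 'v" +
  fixes lhd :: "'v \<Rightarrow> 'v \<Rightarrow> 'v" (infixl "\<lhd>" 70)
    and rhd :: "'v \<Rightarrow> 'v \<Rightarrow> 'v" (infixl "\<rhd>" 70)
  assumes lhd_bilinear: "bilinear_map scale scale (\<lhd>)"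
    and rhd_bilinear: "bilinear_map scale scale (\<rhd>)"
    and pre_novikov1:
      "a \<rhd> (b \<rhd> c) = (a \<rhd> b + a \<lhd> b) \<rhd> c + b \<rhd> (a \<rhd> c) - (b \<rhd> a + b \<lhd> a) \<rhd> c"
    and pre_novikov2:
      "a \<rhd> (b \<lhd> c) = (a \<rhd> b) \<lhd> c + b \<lhd> (a \<lhd> c + a \<rhd> c) - (b \<lhd> a) \<lhd> c"
    and pre_novikov3: "(a \<lhd> b + a \<rhd> b) \<rhd> c = (a \<rhd> c) \<lhd> b"
    and pre_novikov4: "(a \<lhd> b) \<lhd> c = (a \<lhd> c) \<lhd> b"
begin

definition ideal :: "'v set \<Rightarrow> bool" where
  "ideal I \<longleftrightarrow> subspace I \<and>
     (\<forall>a\<in>I. \<forall>b. a \<lhd> b \<in> I \<and> b \<lhd> a \<in> I \<and> a \<rhd> b \<in> I \<and> b \<rhd> a \<in> I)"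

definition proper_ideal :: "'v set \<Rightarrow> bool" where
  "proper_ideal I \<longleftrightarrow> ideal I \<and> I \<noteq> {0} \<and> I \<noteq> UNIV"

end

locale simple_pre_novikov_algebra = pre_novikov_algebra +
  assumes nontrivial: "\<not> (\<forall>a b. lhd a b = 0 \<and> rhd a b = 0)"
    and no_proper_ideal: "\<not> (\<exists>I. proper_ideal I)"

locale pre_gelfand_dorfman_algebra =
  pre_novikov_algebra scale lhd rhd + left_symmetric_algebra scale circ
  for scale :: "complex \<Rightarrow> 'v::ab_group_add \<Rightarrow> 'v"
    and lhd :: "'v \<Rightarrow> 'v \<Rightarrow> 'v" (infixl "\<lhd>" 70)
    and rhd :: "'v \<Rightarrow> 'v \<Rightarrow> 'v" (infixl "\<rhd>" 70)
    and circ :: "'v \<Rightarrow> 'v \<Rightarrow> 'v" (infixl "\<circ>\<^sub>V" 70) +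
  assumes pre_gd1:
      "c \<lhd> (a \<circ>\<^sub>V b - b \<circ>\<^sub>V a) - a \<circ>\<^sub>V (c \<lhd> b) - (b \<circ>\<^sub>V c) \<lhd> a
         = - (b \<circ>\<^sub>V (c \<lhd> a)) - (a \<circ>\<^sub>V c) \<lhd> b"
    and pre_gd2:
      "(a \<circ>\<^sub>V b - b \<circ>\<^sub>V a) \<rhd> c + (a \<lhd> b + a \<rhd> b) \<circ>\<^sub>V c
         = a \<rhd> (b \<circ>\<^sub>V c) - b \<circ>\<^sub>V (a \<rhd> c) + (a \<circ>\<^sub>V c) \<lhd> b"


subsection \<open>Left-symmetric conformal algebras\<close>

text \<open>
  The \<open>\<lambda>\<close>-product \<open>lprod a b\<close> lies in \<open>R[\<lambda>]\<close>. Given a \<open>\<complex>[\<partial>]\<close>-module structure \<open>scale\<close> on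
  \<open>R\<close> and \<open>x, y \<in> \<complex>[\<partial>][\<lambda>][\<mu>]\<close>, the following define the elements \<open>a\<^sub>x b\<close>,
  \<open>(a\<^sub>x b)\<^sub>y c\<close> and \<open>a\<^sub>x (b\<^sub>y c)\<close> of \<open>R[\<lambda>, \<mu>]\<close>: the product of \<open>R\<close> is applied to
  coefficients, and the indeterminates are then replaced by \<open>x\<close> and \<open>y\<close>.
\<close>

definition lprod_at ::
  "(complex poly \<Rightarrow> 'r::ab_group_add \<Rightarrow> 'r) \<Rightarrow> ('r \<Rightarrow> 'r \<Rightarrow> 'r poly)
     \<Rightarrow> complex poly poly poly \<Rightarrow> 'r \<Rightarrow> 'r \<Rightarrow> 'r poly poly" where
  "lprod_at scale lprod x a b =
     (\<Sum>k\<le>degree (lprod a b).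
        poly_act (poly_act scale) (x ^ k) [:[:coeff (lprod a b) k:]:])"

definition lprod_left_nested ::
  "(complex poly \<Rightarrow> 'r::ab_group_add \<Rightarrow> 'r) \<Rightarrow> ('r \<Rightarrow> 'r \<Rightarrow> 'r poly)
     \<Rightarrow> complex poly poly poly \<Rightarrow> complex poly poly poly \<Rightarrow> 'r \<Rightarrow> 'r \<Rightarrow> 'r \<Rightarrow> 'r poly poly" where
  "lprod_left_nested scale lprod x y a b c =
     (\<Sum>k\<le>degree (lprod a b).
        poly_act (poly_act scale) (x ^ k) (lprod_at scale lprod y (coeff (lprod a b) k) c))"

definition lprod_right_nested ::
  "(complex poly \<Rightarrow> 'r::ab_group_add \<Rightarrow> 'r) \<Rightarrow> ('r \<Rightarrow> 'r \<Rightarrow> 'r poly)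
     \<Rightarrow> complex poly poly poly \<Rightarrow> complex poly poly poly \<Rightarrow> 'r \<Rightarrow> 'r \<Rightarrow> 'r \<Rightarrow> 'r poly poly" where
  "lprod_right_nested scale lprod x y a b c =
     (\<Sum>k\<le>degree (lprod b c).
        poly_act (poly_act scale) (y ^ k) (lprod_at scale lprod x a (coeff (lprod b c) k)))"

text \<open>In the sesquilinearity axioms, \<open>[:0, 1:]\<close> is \<open>\<partial>\<close> when acting on \<open>R\<close>; when acting on
  \<open>R[\<lambda>]\<close>, \<open>[:0, 1:]\<close> is \<open>\<lambda>\<close> and \<open>[:[:0, 1:]:]\<close> is \<open>\<partial>\<close>. In the last axiom, \<open>\<lambda>\<close> and
  \<open>\<mu>\<close> are \<open>[:[:0, 1:]:]\<close> and \<open>[:0, 1:]\<close>.\<close>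

locale left_symmetric_conformal_algebra = module scale
  for scale :: "complex poly \<Rightarrow> 'r::ab_group_add \<Rightarrow> 'r" +
  fixes lprod :: "'r \<Rightarrow> 'r \<Rightarrow> 'r poly"
  assumes lprod_bilinear:
      "bilinear_map (\<lambda>z. scale [:z:]) (\<lambda>z. poly_act scale [:[:z:]:]) lprod"
    and sesquilinear_left:
      "lprod (scale [:0, 1:] a) b = poly_act scale (- [:0, 1:]) (lprod a b)"
    and sesquilinear_right:
      "lprod a (scale [:0, 1:] b) = poly_act scale ([:[:0, 1:]:] + [:0, 1:]) (lprod a b)"
    and conformal_left_symmetric:
      "\<lbrakk>l = [:[:0, 1:]:]; m = [:0, 1:]\<rbrakk> \<Longrightarrow>
         lprod_left_nested scale lprod l (l + m) a b c - lprod_right_nested scale lprod l m a b c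
       = lprod_left_nested scale lprod m (l + m) b a c - lprod_right_nested scale lprod m l b a c"
begin

definition ideal :: "'r set \<Rightarrow> bool" where
  "ideal I \<longleftrightarrow> subspace I \<and>
     (\<forall>a\<in>I. \<forall>b n. coeff (lprod a b) n \<in> I \<and> coeff (lprod b a) n \<in> I)"

definition proper_ideal :: "'r set \<Rightarrow> bool" where
  "proper_ideal I \<longleftrightarrow> ideal I \<and> I \<noteq> {0} \<and> I \<noteq> UNIV"

end

locale simple_left_symmetric_conformal_algebra = left_symmetric_conformal_algebra +
  assumes nontrivial: "\<not> (\<forall>a b. lprod a b = 0)"
    and no_proper_ideal: "\<not> (\<exists>I. proper_ideal I)"


subsection \<open>The quadratic left-symmetric conformal algebra\<close>

definition star :: "('v \<Rightarrow> 'v \<Rightarrow> 'v::plus) \<Rightarrow> ('v \<Rightarrow> 'v \<Rightarrow> 'v) \<Rightarrow> 'v \<Rightarrow> 'v \<Rightarrow> 'v" where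
  "star lhd rhd a b = rhd a b + lhd b a"

definition product_span ::
  "(complex \<Rightarrow> 'v::ab_group_add \<Rightarrow> 'v) \<Rightarrow> ('v \<Rightarrow> 'v \<Rightarrow> 'v) \<Rightarrow> 'v set" where
  "product_span scale f = module.span scale {f a b |a b. True}"

text \<open>\<open>\<partial>(b \<lhd> a) + a \<circ> b + \<lambda>(a \<rhd> b + b \<lhd> a)\<close> as an element of \<open>(\<complex>[\<partial>] \<otimes> V)[\<lambda>]\<close>\<close>

definition quadratic_lprod_gen ::
  "('v \<Rightarrow> 'v \<Rightarrow> 'v) \<Rightarrow> ('v \<Rightarrow> 'v \<Rightarrow> 'v) \<Rightarrow> ('v \<Rightarrow> 'v \<Rightarrow> 'v)
     \<Rightarrow> 'v \<Rightarrow> 'v \<Rightarrow> 'v::ab_group_add poly poly" where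
  "quadratic_lprod_gen lhd rhd circ a b = [:[:circ a b, lhd b a:], [:rhd a b + lhd b a:]:]"

text \<open>Extension by \<open>(\<partial>\<^sup>i a)\<^sub>\<lambda> (\<partial>\<^sup>j b) = (-\<lambda>)\<^sup>i (\<partial> + \<lambda>)\<^sup>j (a\<^sub>\<lambda> b)\<close>\<close>

definition quadratic_lprod ::
  "(complex \<Rightarrow> 'v::ab_group_add \<Rightarrow> 'v)
     \<Rightarrow> ('v \<Rightarrow> 'v \<Rightarrow> 'v) \<Rightarrow> ('v \<Rightarrow> 'v \<Rightarrow> 'v) \<Rightarrow> ('v \<Rightarrow> 'v \<Rightarrow> 'v)
     \<Rightarrow> 'v poly \<Rightarrow> 'v poly \<Rightarrow> 'v poly poly" where
  "quadratic_lprod scale lhd rhd circ p q =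
     (\<Sum>i\<le>degree p. \<Sum>j\<le>degree q.
        poly_act (poly_act scale) ((- [:0, 1:]) ^ i * ([:[:0, 1:]:] + [:0, 1:]) ^ j)
          (quadratic_lprod_gen lhd rhd circ (coeff p i) (coeff q j)))"

end

theory Submission
  imports Defs
begin

text \<open>
  Three things have to be shown: the quadratic product satisfies the axioms of a left-symmetric
  conformal algebra, it is not identically zero, and there is no proper ideal. The second is clear,
  because \<open>\<lhd>\<close> and \<open>\<rhd>\<close> can be recovered from the products of generators.

  For the axioms, every product and nested product involved has the form
  \<open>\<Sum>\<^sub>i x\<^sup>i h(p\<^sub>i)\<close>, the value at \<open>x\<close> of a polynomial with coefficients pushed into another
  module by \<open>h\<close> (\<open>module_eval\<close>). Bilinearity and sesquilinearity follow from the rules for this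
  evaluation, and sesquilinearity moves each \<open>\<partial>\<close> out of a nested product as the same scalar from
  all terms of the left-symmetry identity (\<open>defect_del\<close>). Hence that identity only has to be
  checked on generators \<open>a, b, c \<in> V\<close>, where it is an identity between polynomials in
  \<open>\<partial>, \<lambda>, \<mu>\<close>. Comparing coefficients, the quadratic part follows from the pre-Novikov axioms, the
  linear part from the two compatibility axioms, and the constant part from left-symmetry of \<open>\<circ>\<close>
  (\<open>quadratic_identity\<close>).

  For simplicity, let \<open>I\<close> be a nonzero ideal of \<open>R\<close> and let \<open>K \<subseteq> V\<close> be the set of leading
  coefficients of its elements with respect to \<open>\<partial>\<close>. Take \<open>p = \<partial>\<^sup>n v + \<dots>\<close> in \<open>I\<close> and \<open>a \<in> V\<close>.
  The coefficients of \<open>\<lambda>\<^sup>n\<^sup>+\<^sup>1\<close> in \<open>a\<^sub>\<lambda> p\<close> and \<open>p\<^sub>\<lambda> a\<close> are \<open>a \<star> v\<close> and \<open>\<plusminus>(v \<star> a)\<close>, so these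
  elements of \<open>V\<close> lie in \<open>I\<close>. The coefficients of \<open>\<lambda>\<^sup>n\<close> are of degree at most one in \<open>\<partial>\<close>, with
  \<open>\<partial>\<close>-coefficients \<open>v \<lhd> a + n (a \<star> v)\<close> and \<open>\<plusminus>(a \<lhd> v)\<close>. So \<open>v \<lhd> a\<close> and \<open>a \<lhd> v\<close> lie in \<open>K\<close>,
  and then so do \<open>a \<rhd> v = a \<star> v - v \<lhd> a\<close> and \<open>v \<rhd> a\<close>. Thus \<open>K\<close> is a nonzero ideal of the
  simple algebra \<open>(V, \<lhd>, \<rhd>)\<close> (\<open>ideal_leading_coeffs\<close>), whence \<open>K = V\<close>. Applying the first
  observation to all \<open>v \<in> V = K\<close> gives \<open>V \<star> V \<subseteq> I\<close>, and \<open>V = V \<star> V\<close> forces \<open>I = R\<close>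
  (\<open>ideal_eq_UNIV\<close>).
\<close>


section \<open>Polynomials with coefficients in a module\<close>

lemma coeff_poly_act:
  assumes "module s"
  shows "coeff (poly_act s p q) n = (\<Sum>i\<le>n. s (coeff p i) (coeff q (n - i)))"
proof -
  interpret module s by fact
  have inner: "(\<Sum>j\<le>degree q. if i + j = n then s (coeff p i) (coeff q j) else 0)
      = (if i \<le> n then s (coeff p i) (coeff q (n - i)) else 0)" for i
  proof (cases "i \<le> n")
    case True
    then have "(\<Sum>j\<le>degree q. if i + j = n then s (coeff p i) (coeff q j) else 0)
        = (\<Sum>j\<le>degree q. if j = n - i then s (coeff p i) (coeff q j) else 0)"
      by (intro sum.cong) auto
    also have "\<dots> = s (coeff p i) (coeff q (n - i))"
      by (simp add: sum.delta coeff_eq_0)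
    finally show ?thesis using True by simp
  qed (auto intro: sum.neutral)
  have "coeff (poly_act s p q) n
      = (\<Sum>i\<le>degree p. if i \<le> n then s (coeff p i) (coeff q (n - i)) else 0)"
    by (simp add: poly_act_def coeff_sum inner)
  also have "\<dots> = (\<Sum>i\<in>{..degree p} \<inter> {..n}. s (coeff p i) (coeff q (n - i)))"
    by (subst sum.inter_restrict) simp_all
  also have "\<dots> = (\<Sum>i\<le>n. s (coeff p i) (coeff q (n - i)))"
    by (intro sum.mono_neutral_left) (auto intro!: le_degree)
  finally show ?thesis .
qed

lemma poly_act_add_left:
  assumes "module s"
  shows "poly_act s (p + p') q = poly_act s p q + poly_act s p' q"
  by (intro poly_eqI)
    (simp add: coeff_poly_act[OF assms] module.scale_left_distrib[OF assms] sum.distrib)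

lemma poly_act_add_right:
  assumes "module s"
  shows "poly_act s p (q + q') = poly_act s p q + poly_act s p q'"
  by (intro poly_eqI)
    (simp add: coeff_poly_act[OF assms] module.scale_right_distrib[OF assms] sum.distrib)

lemma coeff_poly_act_const:
  assumes "module s"
  shows "coeff (poly_act s [:a:] q) n = s a (coeff q n)"
proof -
  interpret module s by fact
  have "(\<Sum>i\<le>n. s (coeff [:a:] i) (coeff q (n - i))) = (\<Sum>i\<in>{0}. s (coeff [:a:] i) (coeff q (n - i)))"
    by (intro sum.mono_neutral_right) (auto simp: coeff_pCons split: nat.splits)
  then show ?thesis by (simp add: coeff_poly_act[OF assms])
qed

lemma poly_act_pCons_left:
  assumes "module s"
  shows "poly_act s (pCons a p) q = poly_act s [:a:] q + pCons 0 (poly_act s p q)"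
proof (intro poly_eqI)
  fix n
  show "coeff (poly_act s (pCons a p) q) n
      = coeff (poly_act s [:a:] q + pCons 0 (poly_act s p q)) n"
    by (cases n) (simp_all add: coeff_poly_act_const[OF assms] coeff_poly_act[OF assms]
        module.scale_zero_left[OF assms]
        coeff_pCons_Suc sum.atMost_Suc_shift del: sum.atMost_Suc)
qed

lemma poly_act_const_pCons:
  assumes "module s"
  shows "poly_act s [:a:] (pCons v q) = pCons (s a v) (poly_act s [:a:] q)"
  by (intro poly_eqI) (auto simp: coeff_poly_act_const[OF assms] coeff_pCons split: nat.splits)

lemma poly_act_0_right:
  assumes "module s"
  shows "poly_act s p 0 = 0"
  by (intro poly_eqI) (simp add: coeff_poly_act[OF assms] module.scale_zero_right[OF assms])

lemma poly_act_0_left: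
  assumes "module s"
  shows "poly_act s 0 q = 0"
  by (intro poly_eqI) (simp add: coeff_poly_act[OF assms] module.scale_zero_left[OF assms])

lemma poly_act_const_const:
  assumes "module s"
  shows "poly_act s [:a:] [:v:] = [:s a v:]"
  by (simp add: poly_act_const_pCons[OF assms] poly_act_0_right[OF assms])

lemma poly_act_var:
  assumes "module s"
  shows "poly_act s [:0, 1:] q = pCons 0 q"
proof -
  interpret module s by fact
  have "poly_act s [:1:] q = q"
    by (intro poly_eqI) (simp add: coeff_poly_act_const[OF assms])
  then show ?thesis
    using poly_act_pCons_left[OF assms, of 0 "[:1:]" q] by (simp add: poly_act_0_left[OF assms])
qed

lemma poly_act_mult:
  assumes "module s"
  shows "poly_act s (p * p') q = poly_act s p (poly_act s p' q)"
proof (induction p)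
  case 0
  then show ?case by (simp add: poly_act_0_left[OF assms])
next
  case (pCons a p)
  interpret module s by fact
  have "poly_act s (smult a p') q = poly_act s [:a:] (poly_act s p' q)"
    by (intro poly_eqI, unfold coeff_poly_act_const[OF assms])
      (simp add: coeff_poly_act[OF assms] scale_sum_right)
  moreover have "poly_act s (pCons 0 (p * p')) q = pCons 0 (poly_act s (p * p') q)"
    using poly_act_pCons_left[OF assms, of 0 "p * p'" q] by (simp add: poly_act_0_left[OF assms])
  ultimately show ?case
    by (simp add: poly_act_add_left[OF assms] poly_act_pCons_left[OF assms, of a p] pCons.IH)
qed

text \<open>
  This applies repeatedly, making \<open>V[\<partial>]\<close>, \<open>V[\<partial>][\<lambda>]\<close> and \<open>V[\<partial>][\<lambda>][\<mu>]\<close> modules over the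
  corresponding towers of polynomial rings.
\<close>

lemma module_poly_act:
  assumes "module s"
  shows "module (poly_act s)"
proof
  interpret module s by fact
  show "poly_act s 1 q = q" for q
    by (intro poly_eqI) (simp add: one_pCons coeff_poly_act_const[OF assms])
qed (simp_all add: poly_act_add_left poly_act_add_right poly_act_mult assms)

lemma module_restrict_constants:
  assumes "module s"
  shows "module (\<lambda>z. s [:z:])"
proof -
  interpret module s by fact
  show ?thesis
  proof
    show "s [:a + b:] x = s [:a:] x + s [:b:] x" for a b x
      using scale_left_distrib[of "[:a:]" "[:b:]" x] by simp
    show "s [:a:] (s [:b:] x) = s [:a * b:] x" for a b x
      using scale_scale[of "[:a:]" "[:b:]" x] by (simp add: mult.commute)
    show "s [:1:] x = x" for x
      using scale_one[of x] by (simp only: one_pCons)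
  qed (simp_all add: scale_right_distrib)
qed


section \<open>Evaluation of module-valued polynomials\<close>

text \<open>
  With coefficients in the module itself and \<open>h\<close> the identity this is substitution of \<open>x\<close> for the
  variable. A map \<open>h\<close> into a different module is needed because the coefficients of a
  \<open>\<lambda>\<close>-product are usually multiplied by a further element before \<open>\<lambda>\<close> is specialised.
\<close>

definition module_eval ::
  "('a::comm_ring_1 \<Rightarrow> 'n::ab_group_add \<Rightarrow> 'n) \<Rightarrow> ('m::ab_group_add \<Rightarrow> 'n) \<Rightarrow> 'a \<Rightarrow> 'm poly \<Rightarrow> 'n" where
  "module_eval s h x p = (\<Sum>i\<le>degree p. s (x ^ i) (h (coeff p i)))"

context module
begin

lemma module_eval_0:
  assumes "additive h"
  shows "module_eval scale h x 0 = 0"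
  by (simp add: module_eval_def additive.zero[OF assms])

lemma module_eval_eq_sum:
  assumes "additive h" and "degree p \<le> n"
  shows "module_eval scale h x p = (\<Sum>i\<le>n. scale (x ^ i) (h (coeff p i)))"
  unfolding module_eval_def using assms(2)
  by (intro sum.mono_neutral_left) (auto simp: coeff_eq_0 additive.zero[OF assms(1)])

lemma module_eval_pCons:
  assumes "additive h"
  shows "module_eval scale h x (pCons v p) = h v + scale x (module_eval scale h x p)"
proof -
  have "module_eval scale h x (pCons v p)
      = (\<Sum>i\<le>Suc (degree p). scale (x ^ i) (h (coeff (pCons v p) i)))"
    by (intro module_eval_eq_sum assms degree_pCons_le)
  also have "\<dots> = h v + scale x (module_eval scale h x p)"
    by (simp add: sum.atMost_Suc_shift module_eval_def scale_sum_right del: sum.atMost_Suc)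
  finally show ?thesis .
qed

lemma module_eval_add:
  assumes "additive h"
  shows "module_eval scale h x (p + q) = module_eval scale h x p + module_eval scale h x q"
proof -
  let ?n = "max (degree p) (degree q)"
  show ?thesis
    using module_eval_eq_sum[OF assms, of p ?n] module_eval_eq_sum[OF assms, of q ?n]
      module_eval_eq_sum[OF assms, of "p + q" ?n]
    by (simp add: degree_add_le additive.add[OF assms] scale_right_distrib sum.distrib)
qed

lemma module_eval_fun_add:
  "module_eval scale (\<lambda>v. g v + h v) x p = module_eval scale g x p + module_eval scale h x p"
  by (simp add: module_eval_def scale_right_distrib sum.distrib)

lemma module_eval_fun_scale:
  "module_eval scale (\<lambda>v. scale c (h v)) x p = scale c (module_eval scale h x p)"
  by (simp add: module_eval_def scale_sum_right mult.commute)

text \<open>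
  The three rules from here on say how a scalar passes through an evaluation: a scalar \<open>c\<close> of the
  coefficients becomes whatever \<open>h\<close> turns it into, and the variable becomes \<open>x\<close>. The last two
  are stated for \<open>-\<lambda>\<close> and \<open>\<partial> + \<lambda>\<close>, the scalars that occur in sesquilinearity.
\<close>

lemma module_eval_semilinear:
  assumes "additive h" "module t" and h: "\<And>v. h (t c v) = scale c' (h v)"
  shows "module_eval scale h x (poly_act t [:c:] p) = scale c' (module_eval scale h x p)"
proof (induction p)
  case 0
  then show ?case
    by (simp add: poly_act_0_right assms(2) module_eval_0 assms(1))
next
  case (pCons v p)
  then show ?case
    by (simp add: poly_act_const_pCons assms module_eval_pCons scale_right_distrib
        mult.commute)
qed

lemma module_eval_minus_var:
  assumes "additive h" "module t"
  shows "module_eval scale h x (poly_act t (- [:0, 1:]) p) = scale (- x) (module_eval scale h x p)"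
proof -
  interpret t: module "poly_act t" by (rule module_poly_act) fact
  have "module_eval scale h x (poly_act t (- [:0, 1:]) p)
      + module_eval scale h x (poly_act t [:0, 1:] p) = 0"
    by (simp only: module_eval_add[OF assms(1), symmetric] t.scale_left_distrib[symmetric]
        left_minus t.scale_zero_left module_eval_0[OF assms(1)])
  then show ?thesis
    by (simp add: poly_act_var[OF assms(2)] module_eval_pCons[OF assms(1)]
        additive.zero[OF assms(1)] add_eq_0_iff2 del: minus_pCons)
qed

lemma module_eval_shifted_var:
  assumes "additive h" "module t" and "\<And>v. h (t c v) = scale c' (h v)"
  shows "module_eval scale h x (poly_act t ([:c:] + [:0, 1:]) p)
    = scale (c' + x) (module_eval scale h x p)"
proof -
  interpret t: module "poly_act t" by (rule module_poly_act) fact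
  have "module_eval scale h x (poly_act t ([:c:] + [:0, 1:]) p)
      = module_eval scale h x (poly_act t [:c:] p) + module_eval scale h x (poly_act t [:0, 1:] p)"
    by (simp only: module_eval_add[OF assms(1), symmetric] t.scale_left_distrib)
  then show ?thesis
    by (simp add: poly_act_var[OF assms(2)] module_eval_pCons[OF assms(1)]
        additive.zero[OF assms(1)] module_eval_semilinear[OF assms] scale_left_distrib)
qed

end


section \<open>Nested products under conformal sesquilinearity\<close>

locale sesquilinear_product = module scale
  for scale :: "complex poly \<Rightarrow> 'r::ab_group_add \<Rightarrow> 'r" +
  fixes lprod :: "'r \<Rightarrow> 'r \<Rightarrow> 'r poly"
  assumes add_left: "lprod (a + a') b = lprod a b + lprod a' b"
    and add_right: "lprod a (b + b') = lprod a b + lprod a b'"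
    and sesq_left: "lprod (scale [:0, 1:] a) b = poly_act scale (- [:0, 1:]) (lprod a b)"
    and sesq_right:
      "lprod a (scale [:0, 1:] b) = poly_act scale ([:[:0, 1:]:] + [:0, 1:]) (lprod a b)"
begin

abbreviation act :: "complex poly poly poly \<Rightarrow> 'r poly poly \<Rightarrow> 'r poly poly" where
  "act \<equiv> poly_act (poly_act scale)"

abbreviation del :: "complex poly poly poly" where
  "del \<equiv> [:[:[:0, 1:]:]:]"

sublocale M1: module "poly_act scale"
  by (rule module_poly_act) (rule module_axioms)

sublocale M2: module act
  by (rule module_poly_act) (rule M1.module_axioms)

lemma lprod_at_eq_eval: "lprod_at scale lprod x a b = module_eval act (\<lambda>r. [:[:r:]:]) x (lprod a b)"
  by (simp add: lprod_at_def module_eval_def)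

lemma left_nested_eq_eval:
  "lprod_left_nested scale lprod x y a b c
    = module_eval act (\<lambda>r. lprod_at scale lprod y r c) x (lprod a b)"
  by (simp add: lprod_left_nested_def module_eval_def)

lemma right_nested_eq_eval:
  "lprod_right_nested scale lprod x y a b c
    = module_eval act (\<lambda>r. lprod_at scale lprod x a r) y (lprod b c)"
  by (simp add: lprod_right_nested_def module_eval_def)

lemma additive_const_const: "additive (\<lambda>r. [:[:r:]:])"
  by (simp add: additive_def)

lemma const_const_del: "[:[:scale [:0, 1:] r:]:] = act del [:[:r:]:]"
  by (simp add: poly_act_const_const module_axioms M1.module_axioms)

lemma lprod_at_add_left:
  "lprod_at scale lprod x (a + a') b = lprod_at scale lprod x a b + lprod_at scale lprod x a' b"
  by (simp add: lprod_at_eq_eval add_left M2.module_eval_add additive_const_const)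

lemma lprod_at_add_right:
  "lprod_at scale lprod x a (b + b') = lprod_at scale lprod x a b + lprod_at scale lprod x a b'"
  by (simp add: lprod_at_eq_eval add_right M2.module_eval_add additive_const_const)

lemma lprod_at_del_left:
  "lprod_at scale lprod x (scale [:0, 1:] a) b = act (- x) (lprod_at scale lprod x a b)"
  unfolding lprod_at_eq_eval sesq_left
  by (intro M2.module_eval_minus_var additive_const_const module_axioms)

lemma lprod_at_del_right:
  "lprod_at scale lprod x a (scale [:0, 1:] b) = act (del + x) (lprod_at scale lprod x a b)"
  unfolding lprod_at_eq_eval sesq_right
  by (intro M2.module_eval_shifted_var additive_const_const module_axioms const_const_del)

lemma additive_lprod_at_left: "additive (\<lambda>r. lprod_at scale lprod y r c)"
  by (simp add: additive_def lprod_at_add_left)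

lemma additive_lprod_at_right: "additive (\<lambda>r. lprod_at scale lprod y a r)"
  by (simp add: additive_def lprod_at_add_right)

lemma nested_add:
  "lprod_left_nested scale lprod x y (a + a') b c
    = lprod_left_nested scale lprod x y a b c + lprod_left_nested scale lprod x y a' b c"
  "lprod_left_nested scale lprod x y a (b + b') c
    = lprod_left_nested scale lprod x y a b c + lprod_left_nested scale lprod x y a b' c"
  "lprod_left_nested scale lprod x y a b (c + c')
    = lprod_left_nested scale lprod x y a b c + lprod_left_nested scale lprod x y a b c'"
  "lprod_right_nested scale lprod x y (a + a') b c
    = lprod_right_nested scale lprod x y a b c + lprod_right_nested scale lprod x y a' b c"
  "lprod_right_nested scale lprod x y a (b + b') c
    = lprod_right_nested scale lprod x y a b c + lprod_right_nested scale lprod x y a b' c"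
  "lprod_right_nested scale lprod x y a b (c + c')
    = lprod_right_nested scale lprod x y a b c + lprod_right_nested scale lprod x y a b c'"
  by (simp_all add: left_nested_eq_eval right_nested_eq_eval add_left add_right
      lprod_at_add_left lprod_at_add_right M2.module_eval_fun_add
      M2.module_eval_add additive_lprod_at_left additive_lprod_at_right)

text \<open>
  For \<open>x = \<lambda>\<close> and \<open>y = \<lambda> + \<mu>\<close> the three scalars are \<open>-\<lambda>\<close>, \<open>-\<mu>\<close> and \<open>\<partial> + \<lambda> + \<mu>\<close>, the same as
  for the right-nested product at \<open>x = \<lambda>\<close> and \<open>y = \<mu>\<close>.
\<close>

lemma left_nested_del:
  "lprod_left_nested scale lprod x y (scale [:0, 1:] a) b c
    = act (- x) (lprod_left_nested scale lprod x y a b c)"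
  "lprod_left_nested scale lprod x y a (scale [:0, 1:] b) c
    = act (- y + x) (lprod_left_nested scale lprod x y a b c)"
  "lprod_left_nested scale lprod x y a b (scale [:0, 1:] c)
    = act (del + y) (lprod_left_nested scale lprod x y a b c)"
  unfolding left_nested_eq_eval sesq_left sesq_right lprod_at_del_right
  by (intro M2.module_eval_minus_var M2.module_eval_shifted_var M2.module_eval_fun_scale
      additive_lprod_at_left lprod_at_del_left module_axioms)+

lemma right_nested_del:
  "lprod_right_nested scale lprod x y (scale [:0, 1:] a) b c
    = act (- x) (lprod_right_nested scale lprod x y a b c)"
  "lprod_right_nested scale lprod x y a (scale [:0, 1:] b) c
    = act (- y) (lprod_right_nested scale lprod x y a b c)"
  "lprod_right_nested scale lprod x y a b (scale [:0, 1:] c)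
    = act (del + x + y) (lprod_right_nested scale lprod x y a b c)"
  unfolding right_nested_eq_eval sesq_left sesq_right lprod_at_del_left
  by (intro M2.module_eval_minus_var M2.module_eval_shifted_var M2.module_eval_fun_scale
      additive_lprod_at_right lprod_at_del_right module_axioms)+

text \<open>
  Left-symmetry is the vanishing of this map for \<open>l = \<lambda>\<close> and \<open>m = \<mu>\<close>.
\<close>

definition defect ::
  "complex poly poly poly \<Rightarrow> complex poly poly poly \<Rightarrow> 'r \<Rightarrow> 'r \<Rightarrow> 'r \<Rightarrow> 'r poly poly" where
  "defect l m a b c =
     (lprod_left_nested scale lprod l (l + m) a b c - lprod_right_nested scale lprod l m a b c)
   - (lprod_left_nested scale lprod m (l + m) b a c - lprod_right_nested scale lprod m l b a c)"

lemma defect_add: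
  "defect l m (a + a') b c = defect l m a b c + defect l m a' b c"
  "defect l m a (b + b') c = defect l m a b c + defect l m a b' c"
  "defect l m a b (c + c') = defect l m a b c + defect l m a b c'"
  by (simp_all add: defect_def nested_add)

text \<open>
  The exchange of \<open>(a, \<lambda>)\<close> with \<open>(b, \<mu>)\<close> preserves all scalars, so that they factor out of the whole
  defect. This reduces left-symmetry to generators of \<open>R\<close> over \<open>\<complex>[\<partial>]\<close>.
\<close>

lemma defect_del:
  "defect l m (scale [:0, 1:] a) b c = act (- l) (defect l m a b c)"
  "defect l m a (scale [:0, 1:] b) c = act (- m) (defect l m a b c)"
  "defect l m a b (scale [:0, 1:] c) = act (del + l + m) (defect l m a b c)"
  by (simp_all add: defect_def left_nested_del right_nested_del M2.scale_right_diff_distrib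
      ac_simps)

end


section \<open>The conformal identity on generators\<close>

context pre_gelfand_dorfman_algebra
begin

lemma module_scale: "module scale"
  by (rule module_axioms)

lemma lhd_linear:
  "(a + b) \<lhd> c = a \<lhd> c + b \<lhd> c" "a \<lhd> (b + c) = a \<lhd> b + a \<lhd> c"
  "(a - b) \<lhd> c = a \<lhd> c - b \<lhd> c" "a \<lhd> (b - c) = a \<lhd> b - a \<lhd> c"
  "scale z a \<lhd> c = scale z (a \<lhd> c)" "a \<lhd> scale z c = scale z (a \<lhd> c)"
  "0 \<lhd> a = 0" "a \<lhd> 0 = 0"
  using lhd_bilinear unfolding bilinear_map_def
  by (auto dest: module_hom.add module_hom.diff module_hom.scale module_hom.zero)

lemma rhd_linear:
  "(a + b) \<rhd> c = a \<rhd> c + b \<rhd> c" "a \<rhd> (b + c) = a \<rhd> b + a \<rhd> c"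
  "(a - b) \<rhd> c = a \<rhd> c - b \<rhd> c" "a \<rhd> (b - c) = a \<rhd> b - a \<rhd> c"
  "scale z a \<rhd> c = scale z (a \<rhd> c)" "a \<rhd> scale z c = scale z (a \<rhd> c)"
  "0 \<rhd> a = 0" "a \<rhd> 0 = 0"
  using rhd_bilinear unfolding bilinear_map_def
  by (auto dest: module_hom.add module_hom.diff module_hom.scale module_hom.zero)

lemma circ_linear:
  "(a + b) \<circ>\<^sub>V c = a \<circ>\<^sub>V c + b \<circ>\<^sub>V c" "a \<circ>\<^sub>V (b + c) = a \<circ>\<^sub>V b + a \<circ>\<^sub>V c"
  "(a - b) \<circ>\<^sub>V c = a \<circ>\<^sub>V c - b \<circ>\<^sub>V c" "a \<circ>\<^sub>V (b - c) = a \<circ>\<^sub>V b - a \<circ>\<^sub>V c"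
  "scale z a \<circ>\<^sub>V c = scale z (a \<circ>\<^sub>V c)" "a \<circ>\<^sub>V scale z c = scale z (a \<circ>\<^sub>V c)"
  "0 \<circ>\<^sub>V a = 0" "a \<circ>\<^sub>V 0 = 0"
  using circ_bilinear unfolding bilinear_map_def
  by (auto dest: module_hom.add module_hom.diff module_hom.scale module_hom.zero)

text \<open>
  The value of \<open>u\<^sub>x v\<close> on generators is \<open>P x u v\<close>, and \<open>L\<close> and \<open>R\<close> are the two nested products,
  written out by sesquilinearity with \<open>d = \<partial>\<close>. The difference \<open>L - R\<close> is a combination of ten
  monomials in \<open>d, l, m\<close>, and the axioms imply that its coefficients are compatible with the exchange
  of \<open>(a, l)\<close> and \<open>(b, m)\<close>. The coefficient of \<open>d\<^sup>2\<close> uses the fourth pre-Novikov axiom, that of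
  \<open>dl\<close> the second and fourth, \<open>l\<^sup>2\<close> the second, third and fourth, \<open>lm\<close> the first, second and
  fourth; \<open>d\<close> uses the first compatibility axiom, \<open>l\<close> both, and the constant coefficient
  left-symmetry of \<open>\<circ>\<close>.
\<close>

lemma quadratic_identity:
  fixes act :: "'a::comm_ring_1 \<Rightarrow> 'n::ab_group_add \<Rightarrow> 'n" and e :: "'v \<Rightarrow> 'n" and d :: 'a
  assumes "module act" "additive e"
  defines "P \<equiv> \<lambda>x u v. act d (e (v \<lhd> u)) + e (u \<circ>\<^sub>V v) + act x (e (star (\<lhd>) (\<rhd>) u v))"
  defines "L \<equiv> \<lambda>l m a b c. P (l + m) (a \<circ>\<^sub>V b) c + act (- (l + m)) (P (l + m) (b \<lhd> a) c)
      + act l (P (l + m) (star (\<lhd>) (\<rhd>) a b) c)"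
  defines "R \<equiv> \<lambda>l m a b c. act (d + l) (P l a (c \<lhd> b)) + P l a (b \<circ>\<^sub>V c)
      + act m (P l a (star (\<lhd>) (\<rhd>) b c))"
  shows "L l m a b c - R l m a b c = L m l b a c - R m l b a c"
proof -
  interpret N: module act by fact
  interpret e: additive e by fact
  let ?s = "star (\<lhd>) (\<rhd>)"
  define Kdd where "Kdd a b c = - ((c \<lhd> b) \<lhd> a)" for a b c
  define Kdl where "Kdl a b c = c \<lhd> (a \<rhd> b) - (c \<lhd> b) \<lhd> a - ?s a (c \<lhd> b)" for a b c
  define Kdm where "Kdm a b c = - (c \<lhd> (b \<lhd> a)) - ?s b c \<lhd> a" for a b c
  define Kll where "Kll a b c = ?s (a \<rhd> b) c - ?s a (c \<lhd> b)" for a b c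
  define Kmm where "Kmm a b c = - ?s (b \<lhd> a) c" for a b c
  define Klm where "Klm a b c = ?s (a \<rhd> b) c - ?s (b \<lhd> a) c - ?s a (?s b c)" for a b c
  define Kd where "Kd a b c = c \<lhd> (a \<circ>\<^sub>V b) - a \<circ>\<^sub>V (c \<lhd> b) - (b \<circ>\<^sub>V c) \<lhd> a" for a b c
  define Kl where "Kl a b c = (a \<rhd> b) \<circ>\<^sub>V c + ?s (a \<circ>\<^sub>V b) c - a \<circ>\<^sub>V (c \<lhd> b) - ?s a (b \<circ>\<^sub>V c)" for a b c
  define Km where "Km a b c = - ((b \<lhd> a) \<circ>\<^sub>V c) + ?s (a \<circ>\<^sub>V b) c - a \<circ>\<^sub>V ?s b c" for a b c
  define K1 where "K1 a b c = (a \<circ>\<^sub>V b) \<circ>\<^sub>V c - a \<circ>\<^sub>V (b \<circ>\<^sub>V c)" for a b c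
  note lin = lhd_linear(1-4) rhd_linear(1-4) circ_linear(1-4)
  have expand: "L l m a b c - R l m a b c
      = act (d * d) (e (Kdd a b c)) + act (d * l) (e (Kdl a b c)) + act (d * m) (e (Kdm a b c))
      + act (l * l) (e (Kll a b c)) + act (m * m) (e (Kmm a b c)) + act (l * m) (e (Klm a b c))
      + act d (e (Kd a b c)) + act l (e (Kl a b c)) + act m (e (Km a b c)) + e (K1 a b c)"
    for l m a b c
    unfolding L_def R_def P_def Kdd_def Kdl_def Kdm_def Kll_def Kmm_def Klm_def Kd_def Kl_def
      Km_def K1_def star_def
    by (simp add: lin e.add e.diff e.minus N.scale_left_distrib N.scale_right_distrib
        N.scale_left_diff_distrib N.scale_right_diff_distrib algebra_simps)
  have dd: "Kdd a b c = Kdd b a c"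
    by (simp add: Kdd_def pre_novikov4)
  have dl: "Kdl a b c = Kdm b a c" for a b c
    using pre_novikov2[of a c b] pre_novikov4[of c a b]
    by (simp add: Kdl_def Kdm_def star_def lin algebra_simps)
  have ll: "Kll a b c = Kmm b a c" for a b c
    using pre_novikov2[of a c b] pre_novikov4[of c a b] pre_novikov3[of a b c]
    by (simp add: Kll_def Kmm_def star_def lin algebra_simps)
  have lm: "Klm a b c = Klm b a c"
    by (simp add: Klm_def star_def lin pre_novikov2[of a c b] pre_novikov2[of b c a]
        pre_novikov4[of c a b] pre_novikov1[of a b c] algebra_simps)
  have d: "Kd a b c = Kd b a c"
    using pre_gd1[of c a b] by (simp add: Kd_def lin algebra_simps)
  have l: "Kl a b c = Km b a c" for a b c
  proof -
    have 1: "a \<circ>\<^sub>V (c \<lhd> b) = c \<lhd> (a \<circ>\<^sub>V b - b \<circ>\<^sub>V a) - (b \<circ>\<^sub>V c) \<lhd> a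
        + b \<circ>\<^sub>V (c \<lhd> a) + (a \<circ>\<^sub>V c) \<lhd> b"
      using pre_gd1[of c a b] by (simp add: algebra_simps)
    have 2: "a \<rhd> (b \<circ>\<^sub>V c) = (a \<circ>\<^sub>V b - b \<circ>\<^sub>V a) \<rhd> c + (a \<lhd> b + a \<rhd> b) \<circ>\<^sub>V c
        + b \<circ>\<^sub>V (a \<rhd> c) - (a \<circ>\<^sub>V c) \<lhd> b"
      using pre_gd2[of a b c] by (simp add: algebra_simps)
    show ?thesis
      by (simp add: Kl_def Km_def star_def 1 2 lin algebra_simps)
  qed
  have one: "K1 a b c = K1 b a c"
    by (simp add: K1_def left_symmetric)
  show ?thesis
    unfolding expand dd dl ll lm d l one by (simp add: ac_simps)
qed


section \<open>The quadratic product\<close>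

abbreviation S :: "complex poly \<Rightarrow> 'v poly \<Rightarrow> 'v poly" where
  "S \<equiv> poly_act scale"

abbreviation S' :: "complex poly poly \<Rightarrow> 'v poly poly \<Rightarrow> 'v poly poly" where
  "S' \<equiv> poly_act S"

abbreviation gen :: "'v \<Rightarrow> 'v \<Rightarrow> 'v poly poly" where
  "gen \<equiv> quadratic_lprod_gen (\<lhd>) (\<rhd>) (\<circ>\<^sub>V)"

abbreviation qprod :: "'v poly \<Rightarrow> 'v poly \<Rightarrow> 'v poly poly" where
  "qprod \<equiv> quadratic_lprod scale (\<lhd>) (\<rhd>) (\<circ>\<^sub>V)"

lemma module_S: "module S"
  by (rule module_poly_act) (rule module_scale)

lemma module_S': "module S'"
  by (rule module_poly_act) (rule module_S)

lemmas mS = module_scale module_S module_S'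

lemma gen_linear:
  "gen (a + a') b = gen a b + gen a' b" "gen a (b + b') = gen a b + gen a b'"
  "gen (scale z a) b = S' [:[:z:]:] (gen a b)" "gen a (scale z b) = S' [:[:z:]:] (gen a b)"
  "gen 0 b = 0" "gen a 0 = 0"
  by (simp_all add: quadratic_lprod_gen_def lhd_linear rhd_linear circ_linear
      poly_act_const_pCons poly_act_0_right mS scale_right_distrib)

lemma gen_fun_linear:
  "gen (a + a') = (\<lambda>b. gen a b + gen a' b)" "gen (scale z a) = (\<lambda>b. S' [:[:z:]:] (gen a b))"
  by (simp_all add: fun_eq_iff gen_linear)

text \<open>
  The product \<open>v\<^sub>\<lambda> q\<close> of a generator with an arbitrary element. The general product is then an
  evaluation of \<open>p\<close> at \<open>-\<lambda>\<close>, whose coefficients are in turn evaluations of \<open>q\<close> at \<open>\<partial> + \<lambda>\<close>.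
\<close>

definition gen_prod :: "'v \<Rightarrow> 'v poly \<Rightarrow> 'v poly poly" where
  "gen_prod v q = module_eval S' (gen v) ([:[:0, 1:]:] + [:0, 1:]) q"

lemma additive_gen: "additive (gen v)" "additive (\<lambda>v. gen v w)"
  by (simp_all add: additive_def gen_linear)

lemma quadratic_eq_eval: "qprod p q = module_eval S' (\<lambda>v. gen_prod v q) (- [:0, 1:]) p"
  by (simp only: quadratic_lprod_def module_eval_def gen_prod_def
      module.scale_sum_right[OF module_S'] module.scale_scale[OF module_S'])

lemma gen_prod_linear:
  "gen_prod (v + v') q = gen_prod v q + gen_prod v' q"
  "gen_prod v (q + q') = gen_prod v q + gen_prod v q'"
  "gen_prod (scale z v) q = S' [:[:z:]:] (gen_prod v q)"
  "gen_prod v (S [:z:] q) = S' [:[:z:]:] (gen_prod v q)"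
proof -
  show "gen_prod (v + v') q = gen_prod v q + gen_prod v' q"
    unfolding gen_prod_def gen_fun_linear by (rule module.module_eval_fun_add[OF module_S'])
  show "gen_prod (scale z v) q = S' [:[:z:]:] (gen_prod v q)"
    unfolding gen_prod_def gen_fun_linear by (rule module.module_eval_fun_scale[OF module_S'])
  show "gen_prod v (q + q') = gen_prod v q + gen_prod v q'"
    unfolding gen_prod_def by (rule module.module_eval_add[OF module_S' additive_gen(1)])
  show "gen_prod v (S [:z:] q) = S' [:[:z:]:] (gen_prod v q)"
    unfolding gen_prod_def
    by (rule module.module_eval_semilinear[OF module_S' additive_gen(1) module_scale])
      (rule gen_linear(4))
qed

lemma gen_prod_pCons:
  "gen_prod v (pCons w q) = gen v w + S' ([:[:0, 1:]:] + [:0, 1:]) (gen_prod v q)"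
  unfolding gen_prod_def
  by (rule module.module_eval_pCons[OF module_S' additive_gen(1)])

lemma gen_prod_0: "gen_prod v 0 = 0"
  unfolding gen_prod_def by (rule module.module_eval_0[OF module_S' additive_gen(1)])

lemma gen_prod_const: "gen_prod v [:w:] = gen v w"
  by (simp add: gen_prod_pCons gen_prod_0 module.scale_zero_right[OF module_S'] del: add_pCons)

lemma additive_gen_prod: "additive (\<lambda>v. gen_prod v q)"
  by (simp add: additive_def gen_prod_linear)

lemma prod_pCons_left: "qprod (pCons v p) q = gen_prod v q + S' (- [:0, 1:]) (qprod p q)"
  unfolding quadratic_eq_eval
  by (rule module.module_eval_pCons[OF module_S' additive_gen_prod])

lemma prod_gen_left: "qprod [:v:] q = gen_prod v q"
  unfolding quadratic_eq_eval
  by (simp add: module.module_eval_pCons[OF module_S' additive_gen_prod]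
      module.module_eval_0[OF module_S' additive_gen_prod]
      module.scale_zero_right[OF module_S'] del: minus_pCons)

lemma prod_linear:
  "qprod (p + p') q = qprod p q + qprod p' q"
  "qprod p (q + q') = qprod p q + qprod p q'"
  "qprod (S [:z:] p) q = S' [:[:z:]:] (qprod p q)"
  "qprod p (S [:z:] q) = S' [:[:z:]:] (qprod p q)"
proof -
  show "qprod (p + p') q = qprod p q + qprod p' q"
    unfolding quadratic_eq_eval
    by (rule module.module_eval_add[OF module_S' additive_gen_prod])
  show "qprod p (q + q') = qprod p q + qprod p q'"
    unfolding quadratic_eq_eval gen_prod_linear(2)
    by (rule module.module_eval_fun_add[OF module_S'])
  show "qprod (S [:z:] p) q = S' [:[:z:]:] (qprod p q)"
    unfolding quadratic_eq_eval
    by (rule module.module_eval_semilinear[OF module_S' additive_gen_prod module_scale])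
      (rule gen_prod_linear(3))
  show "qprod p (S [:z:] q) = S' [:[:z:]:] (qprod p q)"
    unfolding quadratic_eq_eval gen_prod_linear(4)
    by (rule module.module_eval_fun_scale[OF module_S'])
qed

sublocale Q: sesquilinear_product S qprod
proof (rule sesquilinear_product.intro[OF module_S], unfold_locales)
  show "qprod (S [:0, 1:] p) q = S' (- [:0, 1:]) (qprod p q)" for p q
    by (simp add: poly_act_var mS prod_pCons_left additive.zero[OF additive_gen_prod]
        del: minus_pCons)
  have "gen_prod v (S [:0, 1:] q) = S' ([:[:0, 1:]:] + [:0, 1:]) (gen_prod v q)" for v q
    by (simp only: poly_act_var[OF module_scale] gen_prod_pCons gen_linear add_0)
  then show "qprod p (S [:0, 1:] q) = S' ([:[:0, 1:]:] + [:0, 1:]) (qprod p q)" for p q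
    by (simp only: quadratic_eq_eval module.module_eval_fun_scale[OF module_S'])
qed (simp_all add: prod_linear)

text \<open>
  Every element is reached from generators by addition and \<open>\<partial>\<close>, which is what lifts facts from
  generators to all of \<open>R\<close>.
\<close>

lemma pCons_eq: "pCons v p = [:v:] + S [:0, 1:] p"
  by (simp add: poly_act_var module_scale)

lemma bilinear_prod: "bilinear_map (\<lambda>z. S [:z:]) (\<lambda>z. S' [:[:z:]:]) qprod"
  unfolding bilinear_map_def module_hom_def module_hom_axioms_def
  using module_restrict_constants[OF module_S]
    module_restrict_constants[OF module_restrict_constants[OF module_S']]
  by (simp add: prod_linear)

lemma defect_generators: "Q.defect l m [:a:] [:b:] [:c:] = 0"
proof -
  let ?e = "\<lambda>v::'v. [:[:[:v:]:]:]"
  let ?P = "\<lambda>x u v. Q.act Q.del (?e (v \<lhd> u)) + ?e (u \<circ>\<^sub>V v) + Q.act x (?e (star (\<lhd>) (\<rhd>) u v))"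
  have gen: "qprod [:u:] [:v:] = [:[:u \<circ>\<^sub>V v:] + S [:0, 1:] [:v \<lhd> u:], [:star (\<lhd>) (\<rhd>) u v:]:]" for u v
    by (simp add: prod_gen_left gen_prod_const quadratic_lprod_gen_def star_def
        poly_act_var module_scale)
  have P: "lprod_at S qprod x [:u:] [:v:] = ?P x u v" for x u v
    unfolding Q.lprod_at_eq_eval gen
    by (simp add: Q.M2.module_eval_pCons Q.M2.module_eval_0 Q.additive_const_const
        poly_act_const_const poly_act_var mS ac_simps)
  have L: "lprod_left_nested S qprod l (l + m) [:a:] [:b:] [:c:]
      = ?P (l + m) (a \<circ>\<^sub>V b) c + Q.act (- (l + m)) (?P (l + m) (b \<lhd> a) c)
        + Q.act l (?P (l + m) (star (\<lhd>) (\<rhd>) a b) c)" for l m a b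
    unfolding Q.left_nested_eq_eval gen
    by (simp only: Q.M2.module_eval_pCons Q.M2.module_eval_0 Q.additive_lprod_at_left
        Q.lprod_at_add_left Q.lprod_at_del_left P Q.M2.scale_zero_right add_0_right)
  have R: "lprod_right_nested S qprod l m [:a:] [:b:] [:c:]
      = Q.act (Q.del + l) (?P l a (c \<lhd> b)) + ?P l a (b \<circ>\<^sub>V c)
        + Q.act m (?P l a (star (\<lhd>) (\<rhd>) b c))" for l m a b
    unfolding Q.right_nested_eq_eval gen
    by (simp only: Q.M2.module_eval_pCons Q.M2.module_eval_0 Q.additive_lprod_at_right
        Q.lprod_at_add_right Q.lprod_at_del_right P Q.M2.scale_zero_right add_0_right)
      (simp only: ac_simps)
  have e: "additive ?e"
    by (simp add: additive_def)
  have "lprod_left_nested S qprod l (l + m) [:a:] [:b:] [:c:]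
      - lprod_right_nested S qprod l m [:a:] [:b:] [:c:]
    = lprod_left_nested S qprod m (m + l) [:b:] [:a:] [:c:]
      - lprod_right_nested S qprod m l [:b:] [:a:] [:c:]"
    unfolding L R by (rule quadratic_identity[OF Q.M2.module_axioms e])
  then show ?thesis
    by (simp only: Q.defect_def add.commute[of m l] diff_self)
qed

lemma defect_eq_0: "Q.defect l m p q r = 0"
proof -
  have z1: "Q.defect l m 0 q r = 0" for q r
    using Q.defect_add(1)[of l m 0 0 q r] by simp
  have z2: "Q.defect l m p 0 r = 0" for p r
    using Q.defect_add(2)[of l m p 0 0 r] by simp
  have z3: "Q.defect l m p q 0 = 0" for p q
    using Q.defect_add(3)[of l m p q 0 0] by simp
  have 1: "Q.defect l m [:a:] [:b:] r = 0" for a b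
  proof (induction r)
    case (pCons c r)
    show ?case
      by (subst pCons_eq) (simp only: Q.defect_add Q.defect_del pCons.IH defect_generators
          Q.M2.scale_zero_right add_0_right)
  qed (rule z3)
  have 2: "Q.defect l m [:a:] q r = 0" for a
  proof (induction q)
    case (pCons b q)
    show ?case
      by (subst pCons_eq) (simp only: Q.defect_add Q.defect_del pCons.IH 1
          Q.M2.scale_zero_right add_0_right)
  qed (rule z2)
  show ?thesis
  proof (induction p)
    case (pCons a p)
    show ?case
      by (subst pCons_eq) (simp only: Q.defect_add Q.defect_del pCons.IH 2
          Q.M2.scale_zero_right add_0_right)
  qed (rule z1)
qed

lemma quadratic_left_symmetric_conformal: "left_symmetric_conformal_algebra S qprod"
proof (intro left_symmetric_conformal_algebra.intro left_symmetric_conformal_algebra_axioms.intro)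
  show "lprod_left_nested S qprod l (l + m) a b c - lprod_right_nested S qprod l m a b c
      = lprod_left_nested S qprod m (l + m) b a c - lprod_right_nested S qprod m l b a c"
    for l m a b c
    using defect_eq_0[of l m a b c] by (simp add: Q.defect_def)
qed (rule module_S bilinear_prod Q.sesq_left Q.sesq_right)+


section \<open>Extreme coefficients of products with generators\<close>

lemma coeff_act_del_plus_var:
  "coeff (S' ([:[:0, 1:]:] + [:0, 1:]) Q) (Suc k) = pCons 0 (coeff Q (Suc k)) + coeff Q k"
  by (simp add: poly_act_add_left coeff_poly_act_const poly_act_var mS del: add_pCons)

lemma coeff_act_minus_var: "coeff (S' (- [:0, 1:]) Q) (Suc k) = - coeff Q k"
  by (simp add: Q.M1.scale_minus_left poly_act_var mS del: minus_pCons)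

lemma gen_coeff:
  "coeff (gen a b) 0 = [:a \<circ>\<^sub>V b, b \<lhd> a:]"
  "coeff (gen a b) (Suc 0) = [:star (\<lhd>) (\<rhd>) a b:]"
  "coeff (gen a b) (Suc (Suc k)) = 0"
  by (simp_all add: quadratic_lprod_gen_def star_def)

text \<open>
  In \<open>a\<^sub>\<lambda> p = \<Sum>\<^sub>i (\<partial> + \<lambda>)\<^sup>i (a\<^sub>\<lambda> p\<^sub>i)\<close> only \<open>i = n\<close> reaches \<open>\<lambda>\<^sup>n\<^sup>+\<^sup>1\<close>. For \<open>\<lambda>\<^sup>n\<close>, the terms
  that involve \<open>\<partial>\<close> come from \<open>i = n\<close> as well: one from \<open>\<partial>(p\<^sub>n \<lhd> a)\<close>, and \<open>n\<close> copies of
  \<open>\<partial>(a \<star> p\<^sub>n)\<close> from the binomial expansion.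
\<close>

lemma top_coeffs_prod_gen_left:
  assumes "degree p \<le> n"
  shows "coeff (qprod [:a:] p) (Suc n) = [:star (\<lhd>) (\<rhd>) a (coeff p n):]" (is ?A)
    and "\<exists>u. coeff (qprod [:a:] p) n
      = [:u, coeff p n \<lhd> a + scale (of_nat n) (star (\<lhd>) (\<rhd>) a (coeff p n)):]" (is ?B)
proof -
  \<comment> \<open>Multiplication by \<open>\<partial> + \<lambda>\<close> adds \<open>\<partial>\<close> times the coefficient of \<open>\<lambda>\<^sup>k\<^sup>+\<^sup>1\<close> to that of \<open>\<lambda>\<^sup>k\<close>, so the
    induction also has to carry the vanishing above \<open>n + 1\<close>.\<close>
  have "(\<forall>k>Suc n. coeff (gen_prod a p) k = 0)
    \<and> coeff (gen_prod a p) (Suc n) = [:star (\<lhd>) (\<rhd>) a (coeff p n):]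
    \<and> (\<exists>u. coeff (gen_prod a p) n
      = [:u, coeff p n \<lhd> a + scale (of_nat n) (star (\<lhd>) (\<rhd>) a (coeff p n)):])"
    using assms
  proof (induction n arbitrary: p)
    case 0
    then obtain v where "p = [:v:]" by (auto elim: degree_eq_zeroE)
    moreover have "coeff (gen a v) k = 0" if "k > Suc 0" for k
      using that gen_coeff(3)[of a v "k - 2"] by (auto simp: numeral_2_eq_2 Suc_diff_Suc)
    ultimately show ?case by (simp add: gen_prod_const gen_coeff)
  next
    case (Suc n)
    obtain v q where p: "p = pCons v q" by (cases p)
    with Suc.prems have "degree q \<le> n" by (cases "q = 0") auto
    note IH = Suc.IH[OF this]
    have c: "coeff (gen_prod a p) (Suc k)
        = coeff (gen a v) (Suc k) + (pCons 0 (coeff (gen_prod a q) (Suc k)) + coeff (gen_prod a q) k)" for k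
      by (simp only: p gen_prod_pCons coeff_add coeff_act_del_plus_var)
    from IH obtain u where u: "coeff (gen_prod a q) n
      = [:u, coeff q n \<lhd> a + scale (of_nat n) (star (\<lhd>) (\<rhd>) a (coeff q n)):]" by blast
    obtain w where "coeff (gen a v) (Suc n) = [:w:]"
      by (cases n) (auto simp: gen_coeff intro: that[of 0])
    then have "\<exists>u. coeff (gen_prod a p) (Suc n)
      = [:u, coeff p (Suc n) \<lhd> a + scale (of_nat (Suc n)) (star (\<lhd>) (\<rhd>) a (coeff p (Suc n))):]"
      unfolding c using IH u by (simp add: p scale_left_distrib algebra_simps)
    moreover have "coeff (gen_prod a p) k = 0" if "k > Suc (Suc n)" for k
    proof -
      from that obtain j where "k = Suc (Suc j)" "j > n"
        by (cases k; cases "k - 1") auto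
      then show ?thesis using IH by (simp only: c gen_coeff) simp
    qed
    moreover have "coeff (gen_prod a p) (Suc (Suc n)) = [:star (\<lhd>) (\<rhd>) a (coeff p (Suc n)):]"
      unfolding c using IH by (simp add: p gen_coeff)
    ultimately show ?case by simp
  qed
  then show ?A ?B by (simp_all add: prod_gen_left)
qed

text \<open>
  On this side only powers of \<open>-\<lambda>\<close> occur, so all coefficients are explicit: \<open>\<lambda>\<^sup>k\<close> collects the
  part of \<open>(p\<^sub>k)\<^sub>\<lambda> b\<close> free of \<open>\<lambda>\<close> and the \<open>\<lambda>\<close>-part of \<open>(p\<^sub>k\<^sub>-\<^sub>1)\<^sub>\<lambda> b\<close>, with opposite signs.
\<close>

lemma coeff_prod_gen_right:
  "coeff (qprod p [:b:]) k = (if even k then id else uminus)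
     ([:coeff p k \<circ>\<^sub>V b, b \<lhd> coeff p k:]
       - (if k = 0 then 0 else [:star (\<lhd>) (\<rhd>) (coeff p (k - 1)) b:]))"
proof (induction p arbitrary: k)
  case 0
  then show ?case
    by (simp add: additive.zero[of "\<lambda>p. qprod p [:b:]"] additive_def prod_linear
        lhd_linear circ_linear rhd_linear star_def)
next
  case (pCons v p)
  show ?case
  proof (cases k)
    case 0
    have "coeff (S' (- [:0, 1:]) Q) 0 = 0" for Q
      by (simp add: Q.M1.scale_minus_left poly_act_var mS del: minus_pCons)
    then show ?thesis
      by (simp only: 0 prod_pCons_left coeff_add gen_prod_const gen_coeff) simp
  next
    case (Suc j)
    then show ?thesis
      by (simp only: prod_pCons_left coeff_add gen_prod_const coeff_act_minus_var pCons.IH)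
        (cases j; simp add: gen_coeff)
  qed
qed


section \<open>Ideals and simplicity\<close>

sublocale C: left_symmetric_conformal_algebra S qprod
  by (rule quadratic_left_symmetric_conformal)

text \<open>
  Bounding the degree instead of fixing it includes \<open>0\<close> and makes the set closed under sums whose
  leading terms cancel.
\<close>

definition leading_coeffs :: "'v poly set \<Rightarrow> 'v set" where
  "leading_coeffs I = {v. \<exists>n p. p \<in> I \<and> degree p \<le> n \<and> coeff p n = v}"

lemma leading_coeffsI:
  assumes "p \<in> I" and "degree p \<le> n"
  shows "coeff p n \<in> leading_coeffs I"
  using assms unfolding leading_coeffs_def by blast

context
  fixes I :: "'v poly set"
  assumes I: "C.ideal I"
begin

lemma subspace_I: "Q.subspace I"
  using I by (simp add: C.ideal_def)

lemma coeff_prod_mem: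
  assumes "p \<in> I"
  shows "coeff (qprod p q) n \<in> I" and "coeff (qprod q p) n \<in> I"
  using I assms by (simp_all add: C.ideal_def)

text \<open>
  Multiplication by \<open>\<partial>\<close> brings two elements of \<open>I\<close> to a common degree, which is what sums of
  leading coefficients require.
\<close>

lemma leading_coeff_shift:
  assumes "p \<in> I" and "degree p \<le> n" and "n \<le> m"
  shows "\<exists>q\<in>I. degree q \<le> m \<and> coeff q m = coeff p n"
  using assms(3)
proof (induction m rule: dec_induct)
  case base
  then show ?case using assms(1,2) by blast
next
  case (step m)
  then obtain q where q: "q \<in> I" "degree q \<le> m" "coeff q m = coeff p n" by blast
  have "pCons 0 q \<in> I"
    using Q.subspace_scale[OF subspace_I q(1), of "[:0, 1:]"] by (simp add: poly_act_var module_scale)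
  moreover have "degree (pCons 0 q) \<le> Suc m"
    using q(2) degree_pCons_le[of 0 q] by linarith
  ultimately show ?case using q(3) by (intro bexI[of _ "pCons 0 q"]) auto
qed

lemma subspace_leading_coeffs: "subspace (leading_coeffs I)"
proof (rule subspaceI)
  show "0 \<in> leading_coeffs I"
    using leading_coeffsI[of 0 I 0] Q.subspace_0[OF subspace_I] by simp
  show "v + w \<in> leading_coeffs I" if vw: "v \<in> leading_coeffs I" "w \<in> leading_coeffs I" for v w
  proof -
    obtain n p m q where p: "p \<in> I" "degree p \<le> n" "coeff p n = v"
      and q: "q \<in> I" "degree q \<le> m" "coeff q m = w"
      using vw unfolding leading_coeffs_def by blast
    obtain p' where p': "p' \<in> I" "degree p' \<le> max n m" "coeff p' (max n m) = v"
      using leading_coeff_shift[OF p(1,2), of "max n m"] p(3) by auto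
    obtain q' where q': "q' \<in> I" "degree q' \<le> max n m" "coeff q' (max n m) = w"
      using leading_coeff_shift[OF q(1,2), of "max n m"] q(3) by auto
    show ?thesis
      using leading_coeffsI[OF Q.subspace_add[OF subspace_I p'(1) q'(1)] degree_add_le[OF p'(2) q'(2)]]
        p'(3) q'(3) by simp
  qed
  show "scale z v \<in> leading_coeffs I" if v: "v \<in> leading_coeffs I" for z v
  proof -
    obtain n p where p: "p \<in> I" "degree p \<le> n" "coeff p n = v"
      using v unfolding leading_coeffs_def by blast
    have "degree (S [:z:] p) \<le> n"
      using p(2) by (intro degree_le) (simp add: coeff_poly_act_const module_scale coeff_eq_0)
    then show ?thesis
      using leading_coeffsI[OF Q.subspace_scale[OF subspace_I p(1), of "[:z:]"], of n] p(3)
      by (simp add: coeff_poly_act_const module_scale)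
  qed
qed

text \<open>
  The top \<open>\<lambda>\<close>-coefficients of the products with \<open>a\<close> are free of \<open>\<partial>\<close>, so \<open>\<star>\<close>-products with a
  leading coefficient lie in \<open>I\<close> itself and not merely among its leading coefficients.
\<close>

lemma star_mem:
  assumes "v \<in> leading_coeffs I"
  shows "[:star (\<lhd>) (\<rhd>) a v:] \<in> I" and "[:star (\<lhd>) (\<rhd>) v a:] \<in> I"
proof -
  obtain n p where p: "p \<in> I" "degree p \<le> n" "coeff p n = v"
    using assms unfolding leading_coeffs_def by blast
  show "[:star (\<lhd>) (\<rhd>) a v:] \<in> I"
    using coeff_prod_mem(2)[OF p(1), of "[:a:]" "Suc n"] top_coeffs_prod_gen_left(1)[OF p(2)] p(3)
    by simp
  have "coeff p (Suc n) = 0"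
    using p(2) by (simp add: coeff_eq_0)
  then have "coeff (qprod p [:a:]) (Suc n) = (if even n then id else uminus) [:star (\<lhd>) (\<rhd>) v a:]"
    using p(3) by (simp add: coeff_prod_gen_right circ_linear lhd_linear)
  with coeff_prod_mem(1)[OF p(1), of "[:a:]" "Suc n"] show "[:star (\<lhd>) (\<rhd>) v a:] \<in> I"
    using Q.subspace_neg[OF subspace_I, of "- [:star (\<lhd>) (\<rhd>) v a:]"] by (auto split: if_splits)
qed

text \<open>
  The coefficients of \<open>\<lambda>\<^sup>n\<close> provide both products \<open>\<lhd>\<close>, up to multiples of \<open>a \<star> v\<close>; the products
  \<open>\<rhd>\<close> are the differences between \<open>\<star>\<close>-products and these.
\<close>

lemma ideal_leading_coeffs: "ideal (leading_coeffs I)"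
  unfolding ideal_def
proof (intro conjI ballI allI)
  let ?K = "leading_coeffs I"
  note sub = subspace_leading_coeffs
  show "subspace ?K" by (rule sub)
  fix v a assume v: "v \<in> ?K"
  then obtain n p where p: "p \<in> I" "degree p \<le> n" "coeff p n = v"
    unfolding leading_coeffs_def by blast
  have linear: "w \<in> ?K" if "[:u, w:] \<in> I" for u w
    using leading_coeffsI[OF that, of 1] degree_pCons_le[of u "[:w:]"] by simp
  have star: "star (\<lhd>) (\<rhd>) a v \<in> ?K" "star (\<lhd>) (\<rhd>) v a \<in> ?K"
    using star_mem[OF v, of a, THEN leading_coeffsI, of 0] by simp_all
  obtain u where "coeff (qprod [:a:] p) n = [:u, v \<lhd> a + scale (of_nat n) (star (\<lhd>) (\<rhd>) a v):]"
    using top_coeffs_prod_gen_left(2)[OF p(2)] p(3) by blast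
  then have "v \<lhd> a + scale (of_nat n) (star (\<lhd>) (\<rhd>) a v) \<in> ?K"
    using coeff_prod_mem(2)[OF p(1), of "[:a:]" n] by (simp add: linear)
  from subspace_diff[OF sub this subspace_scale[OF sub star(1)], of "of_nat n"]
  show va: "v \<lhd> a \<in> ?K" by simp
  obtain u where "coeff (qprod p [:a:]) n = (if even n then id else uminus) [:u, a \<lhd> v:]"
    using p(3) by (cases n) (auto simp: coeff_prod_gen_right)
  with coeff_prod_mem(1)[OF p(1), of "[:a:]" n] have "[:u, a \<lhd> v:] \<in> I"
    using Q.subspace_neg[OF subspace_I, of "- [:u, a \<lhd> v:]"] by (auto split: if_splits)
  then show av: "a \<lhd> v \<in> ?K" by (rule linear)
  show "v \<rhd> a \<in> ?K"
    using subspace_diff[OF sub star(2) av] by (simp add: star_def)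
  show "a \<rhd> v \<in> ?K"
    using subspace_diff[OF sub star(1) va] by (simp add: star_def)
qed

text \<open>
  Once every vector is a leading coefficient, \<open>I\<close> contains \<open>V \<star> V\<close>, and hence a set of generators
  of \<open>R\<close> over \<open>\<complex>[\<partial>]\<close>.
\<close>

lemma ideal_eq_UNIV:
  assumes "leading_coeffs I = UNIV" and "product_span scale (star (\<lhd>) (\<rhd>)) = UNIV"
  shows "I = UNIV"
proof -
  have "subspace {v. [:v:] \<in> I}"
  proof (rule subspaceI)
    show "v + w \<in> {v. [:v:] \<in> I}" if "v \<in> {v. [:v:] \<in> I}" "w \<in> {v. [:v:] \<in> I}" for v w
      using that Q.subspace_add[OF subspace_I, of "[:v:]" "[:w:]"] by simp
    show "scale z v \<in> {v. [:v:] \<in> I}" if "v \<in> {v. [:v:] \<in> I}" for z v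
      using that Q.subspace_scale[OF subspace_I, of "[:v:]" "[:z:]"]
      by (simp add: poly_act_const_const module_scale)
  qed (simp add: Q.subspace_0[OF subspace_I])
  then have "span {star (\<lhd>) (\<rhd>) a b |a b. True} \<subseteq> {v. [:v:] \<in> I}"
    using star_mem(1) assms(1) by (intro span_minimal) auto
  then have const: "[:v:] \<in> I" for v
    using assms(2) by (auto simp: product_span_def)
  have "p \<in> I" for p
  proof (induction p)
    case 0
    show ?case by (rule Q.subspace_0[OF subspace_I])
  next
    case (pCons v p)
    show ?case
      by (subst pCons_eq)
        (intro Q.subspace_add[OF subspace_I] Q.subspace_scale[OF subspace_I] const pCons.IH)
  qed
  then show ?thesis by blast
qed

lemma leading_coeffs_nonzero:
  assumes "I \<noteq> {0}"
  shows "leading_coeffs I \<noteq> {0}"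
proof -
  obtain p where "p \<in> I" "p \<noteq> 0"
    using assms Q.subspace_0[OF subspace_I] by blast
  then show ?thesis
    using leading_coeffsI[of p I "degree p"] leading_coeff_0_iff[of p] by blast
qed

end

lemma operations_eq_0_if_qprod_eq_0:
  assumes "\<forall>p q. qprod p q = 0"
  shows "a \<lhd> b = 0" and "a \<rhd> b = 0"
proof -
  have 0: "gen a b = 0" for a b
    using assms prod_gen_left[of a "[:b:]"] by (simp add: gen_prod_const)
  have l: "b \<lhd> a = 0" and r: "a \<rhd> b + b \<lhd> a = 0" for a b
    using 0[of a b] by (auto simp: quadratic_lprod_gen_def)
  show "a \<lhd> b = 0" by (rule l)
  show "a \<rhd> b = 0" using r[of a b] by (simp add: l)
qed

end

theorem theorem4p4:
  fixes scale :: "complex \<Rightarrow> 'v::ab_group_add \<Rightarrow> 'v"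
    and lhd rhd circ :: "'v \<Rightarrow> 'v \<Rightarrow> 'v"
  assumes "pre_gelfand_dorfman_algebra scale lhd rhd circ"
    and "simple_pre_novikov_algebra scale lhd rhd"
    and "UNIV = product_span scale (star lhd rhd)"
  shows "simple_left_symmetric_conformal_algebra (poly_act scale)
           (quadratic_lprod scale lhd rhd circ)"
proof -
  interpret pre_gelfand_dorfman_algebra scale lhd rhd circ by fact
  interpret simple_pre_novikov_algebra scale lhd rhd by fact
  show ?thesis
  proof
    show "\<not> (\<forall>p q. quadratic_lprod scale lhd rhd circ p q = 0)"
      using operations_eq_0_if_qprod_eq_0 nontrivial by blast
    show "\<not> (\<exists>I. C.proper_ideal I)"
    proof
      assume "\<exists>I. C.proper_ideal I"
      then obtain I where I: "C.ideal I" "I \<noteq> {0}" "I \<noteq> UNIV"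
        by (auto simp: C.proper_ideal_def)
      then have "leading_coeffs I = UNIV"
        using ideal_leading_coeffs leading_coeffs_nonzero no_proper_ideal
        by (auto simp: proper_ideal_def)
      then show False
        using ideal_eq_UNIV[OF I(1)] I(3) assms(3) by simp
    qed
  qed
qed

end
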